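(* Let $t,v$ be integers with $t,v\ge 2$. Then \[ d(t,v)\le\frac{v(t-1)}{\log\left(\frac{v^{t-1}}{v^{t-1}-1}\right)} . \]
   Context: The logarithm is the natural logarithm. For positive integers $N,t,k,v$ with $k\ge t\ge 2$ and $v\ge 2$, a covering array $\mathsf{CA}(N;t,k,v)$ is an $N\times k$ array $A$ with entries from an alphabet $\Sigma$ of size $v$ such that for every $N\times t$ subarray $B$ of $A$ (obtained by choosing $t$ of the $k$ columns) and every $\mathbf{x}\in\Sigma^{t}$, some row of $B$ equals $\mathbf{x}$. $\mathsf{CAN}(t,k,v)$ is the smallest $N$ for which a $\mathsf{CA}(N;t,k,v)$ exists. Define \[ d(t,v)=\limsup_{k\to\infty}\frac{\mathsf{CAN}(t,k,v)}{\log k}. \] *)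

theory Defs
  imports Complex_Main "HOL-Library.FuncSet" "HOL-Library.Extended_Real"
begin

text \<open>
  An array is a function from row and column indices to entries; only the rows \<open>i < N\<close> and the
  columns \<open>j < k\<close> matter. The chosen \<open>t\<close> columns form a set \<open>S\<close>, and a vector of \<open>t\<close> symbols is
  indexed directly by the columns in \<open>S\<close>.
\<close>

definition covering_array ::
    "nat \<Rightarrow> nat \<Rightarrow> nat \<Rightarrow> 'a set \<Rightarrow> (nat \<Rightarrow> nat \<Rightarrow> 'a) \<Rightarrow> bool" where
  "covering_array N t k \<Sigma> A \<longleftrightarrow>
     (\<forall>i<N. \<forall>j<k. A i j \<in> \<Sigma>) \<and>
     (\<forall>S. S \<subseteq> {..<k} \<and> card S = t \<longrightarrow>
        (\<forall>x \<in> S \<rightarrow>\<^sub>E \<Sigma>. \<exists>i<N. \<forall>j\<in>S. A i j = x j))"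

text \<open>
  Existence of a covering array does not depend on the nature of the symbols, so alphabets are
  taken to be sets of natural numbers.
\<close>

definition CA_exists :: "nat \<Rightarrow> nat \<Rightarrow> nat \<Rightarrow> nat \<Rightarrow> bool" where
  "CA_exists N t k v \<longleftrightarrow>
     (\<exists>(\<Sigma> :: nat set) A. finite \<Sigma> \<and> card \<Sigma> = v \<and> covering_array N t k \<Sigma> A)"

definition CAN :: "nat \<Rightarrow> nat \<Rightarrow> nat \<Rightarrow> nat" where
  "CAN t k v = (LEAST N. 0 < N \<and> CA_exists N t k v)"

text \<open>
  The limit superior is taken in the extended reals, so that it is defined without assuming
  boundedness. The finitely many terms with \<open>k < max t 2\<close> are irrelevant.
\<close>

definition CAN_limsup :: "nat \<Rightarrow> nat \<Rightarrow> ereal" where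
  "CAN_limsup t v = limsup (\<lambda>k. ereal (real (CAN t k v) / ln (real k)))"

end

theory Submission
  imports Defs
begin

text \<open>
  Call a row \<open>r\<close> good for a set \<open>S\<close> of \<open>t\<close> columns and a vector \<open>x\<close> on \<open>S\<close> if some cyclic shift of
  \<open>r\<close> modulo \<open>v\<close> agrees with \<open>x\<close> on \<open>S\<close>. A uniformly random row is good for \<open>(S, x)\<close> with
  probability \<open>v / v ^ t\<close>, so choosing rows greedily on \<open>2 * k\<close> columns leaves after \<open>n\<close> steps at most
  \<open>(2 * k choose t) * v ^ t * (1 - v / v ^ t) ^ n\<close> pairs without a good row. Once this is at most
  \<open>k\<close>, deleting one column for each such pair leaves \<open>k\<close> columns on which the \<open>v * n\<close> shifts of the
  chosen rows form a covering array. The smallest such \<open>n\<close> is asymptotically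
  \<open>(t - 1) * ln k / ln (v ^ (t - 1) / (v ^ (t - 1) - 1))\<close>.
\<close>

section \<open>Greedy choice of rows by averaging, and deletion of columns\<close>

lemma exists_average_cover:
  fixes C :: "'a \<Rightarrow> 'b \<Rightarrow> bool" and p :: real
  assumes "finite R" "R \<noteq> {}" "finite W"
    and cover: "\<And>u. u \<in> W \<Longrightarrow> p * card R \<le> card {r \<in> R. C r u}"
  shows "\<exists>r\<in>R. p * card W \<le> card {u \<in> W. C r u}"
proof (rule ccontr)
  assume "\<not> ?thesis"
  then have less: "\<And>r. r \<in> R \<Longrightarrow> card {u \<in> W. C r u} < p * card W"
    by force
  \<comment> \<open>Double counting of the pairs with \<open>C r u\<close>: by rows the total would
    be below \<open>p * card R * card W\<close>, while by elements of \<open>W\<close> it is at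
    least that.\<close>
  have "(\<Sum>r\<in>R. card {u \<in> W. C r u}) = (\<Sum>u\<in>W. card {r \<in> R. C r u})"
    by (rule sum_multicount_gen) (use assms in auto)
  then have "(\<Sum>u\<in>W. real (card {r \<in> R. C r u})) = (\<Sum>r\<in>R. real (card {u \<in> W. C r u}))"
    by (simp flip: of_nat_sum)
  also have "\<dots> < (\<Sum>r\<in>R. p * card W)"
    using assms less by (intro sum_strict_mono) auto
  also have "\<dots> = (\<Sum>u\<in>W. p * card R)"
    by simp
  also have "\<dots> \<le> (\<Sum>u\<in>W. real (card {r \<in> R. C r u}))"
    using cover by (intro sum_mono)
  finally show False
    by simp
qed

text \<open>The covering hypothesis speaks of single elements, so it passes to the set
  \<open>W\<close> of elements still uncovered. By averaging, some row covers a fraction at least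
  \<open>p\<close> of \<open>W\<close>, and adding it multiplies the number left by at most
  \<open>1 - p\<close>.\<close>

lemma greedy_cover:
  fixes C :: "'a \<Rightarrow> 'b \<Rightarrow> bool" and p :: real
  assumes "finite R" "R \<noteq> {}" "finite U" "p \<le> 1"
    and cover: "\<And>u. u \<in> U \<Longrightarrow> p * card R \<le> card {r \<in> R. C r u}"
  shows "\<exists>\<rho>. (\<forall>i<n. \<rho> i \<in> R) \<and>
    card {u \<in> U. \<forall>i<n. \<not> C (\<rho> i) u} \<le> (1 - p) ^ n * card U"
proof (induction n)
  case 0
  then show ?case by simp
next
  case (Suc n)
  then obtain \<rho> where \<rho>: "\<And>i. i < n \<Longrightarrow> \<rho> i \<in> R"
    and bound: "card {u \<in> U. \<forall>i<n. \<not> C (\<rho> i) u} \<le> (1 - p) ^ n * card U"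
    by blast
  define W where "W = {u \<in> U. \<forall>i<n. \<not> C (\<rho> i) u}"
  have "finite W" "W \<subseteq> U"
    using \<open>finite U\<close> by (auto simp: W_def)
  then obtain r where r: "r \<in> R" "p * card W \<le> card {u \<in> W. C r u}"
    using exists_average_cover[OF assms(1,2) \<open>finite W\<close>, of p C] cover by blast
  define \<rho>' where "\<rho>' = \<rho>(n := r)"
  have eq: "{u \<in> U. \<forall>i<Suc n. \<not> C (\<rho>' i) u} = W - {u \<in> W. C r u}"
    by (auto simp: W_def \<rho>'_def less_Suc_eq)
  have "real (card (W - {u \<in> W. C r u})) = real (card W) - real (card {u \<in> W. C r u})"
    using \<open>finite W\<close> by (subst card_Diff_subset) (auto intro!: of_nat_diff card_mono)
  also have "\<dots> \<le> (1 - p) * card W"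
    using r(2) by (simp add: left_diff_distrib)
  also have "\<dots> \<le> (1 - p) * ((1 - p) ^ n * card U)"
    using bound \<open>p \<le> 1\<close> by (intro mult_left_mono) (auto simp: W_def)
  finally have "card {u \<in> U. \<forall>i<Suc n. \<not> C (\<rho>' i) u} \<le> (1 - p) ^ Suc n * card U"
    by (simp add: eq mult.assoc)
  moreover have "\<forall>i<Suc n. \<rho>' i \<in> R"
    using \<rho> r by (auto simp: \<rho>'_def less_Suc_eq)
  ultimately show ?case
    by blast
qed

text \<open>Removing one chosen point of every member of \<open>F\<close> destroys all of them and
  costs at most \<open>card F\<close> points.\<close>

lemma exists_subset_avoiding:
  assumes "finite X" "finite F" "{} \<notin> F" "k + card F \<le> card X"
  shows "\<exists>Y\<subseteq>X. card Y = k \<and> (\<forall>S\<in>F. \<not> S \<subseteq> Y)"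
proof -
  define f where "f S = (SOME x. x \<in> S)" for S :: "'a set"
  have f: "f S \<in> S" if "S \<in> F" for S
    using that assms(3) unfolding f_def by (metis some_in_eq)
  have "k \<le> card X - card (f ` F)"
    using assms(4) card_image_le[OF \<open>finite F\<close>, of f] by linarith
  also have "\<dots> \<le> card (X - f ` F)"
    using \<open>finite F\<close> by (intro diff_card_le_card_Diff) simp
  finally obtain Y where "Y \<subseteq> X - f ` F" "card Y = k"
    using obtain_subset_with_card_n by metis
  then show ?thesis
    using f by (intro exI[of _ Y]) blast
qed

section \<open>Rows up to cyclic shift modulo \<open>v\<close>\<close>

definition shift_agrees :: "nat \<Rightarrow> (nat \<Rightarrow> nat) \<Rightarrow> nat set \<times> (nat \<Rightarrow> nat) \<Rightarrow> bool" where
  "shift_agrees v r = (\<lambda>(S, x). \<exists>c<v. \<forall>j\<in>S. r j = (x j + c) mod v)"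

lemma card_PiE_fixed_on:
  assumes "finite I" "S \<subseteq> I" "\<And>j. j \<in> S \<Longrightarrow> f j \<in> B"
  shows "card {r \<in> I \<rightarrow>\<^sub>E B. \<forall>j\<in>S. r j = f j} = card B ^ (card I - card S)"
proof -
  have "{r \<in> I \<rightarrow>\<^sub>E B. \<forall>j\<in>S. r j = f j} = PiE I (\<lambda>j. if j \<in> S then {f j} else B)"
    (is "?L = ?R")
  proof
    show "?L \<subseteq> ?R"
      by (auto simp: PiE_iff extensional_def)
    show "?R \<subseteq> ?L"
    proof
      fix r
      assume r: "r \<in> ?R"
      then have agree: "r j = f j" if "j \<in> S" for j
        using that \<open>S \<subseteq> I\<close> PiE_mem[OF r, of j] by auto
      have "r j \<in> B" if "j \<in> I" for j
        using agree assms(3) PiE_mem[OF r that] by (cases "j \<in> S") auto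
      then show "r \<in> ?L"
        using r agree by (simp add: PiE_iff)
    qed
  qed
  then have "card {r \<in> I \<rightarrow>\<^sub>E B. \<forall>j\<in>S. r j = f j} = (\<Prod>j\<in>I. if j \<in> S then 1 else card B)"
    using \<open>finite I\<close> by (auto simp: card_PiE intro!: prod.cong)
  also have "\<dots> = card B ^ card (I - S)"
    using \<open>finite I\<close> by (simp add: prod.If_cases Diff_eq)
  also have "card (I - S) = card I - card S"
    using \<open>S \<subseteq> I\<close> finite_subset[OF \<open>S \<subseteq> I\<close> \<open>finite I\<close>] by (rule card_Diff_subset[rotated])
  finally show ?thesis .
qed

text \<open>Shifts of \<open>x\<close> by distinct constants below \<open>v\<close> differ at every
  column of \<open>S\<close>. As \<open>S\<close> is nonempty, the rows that extend them form
  \<open>v\<close> disjoint classes, and each class leaves \<open>K - card S\<close> entries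
  free.\<close>

lemma card_shift_agrees:
  assumes "S \<subseteq> {..<K}" "S \<noteq> {}" "x \<in> S \<rightarrow>\<^sub>E {..<v}"
  shows "card {r \<in> {..<K} \<rightarrow>\<^sub>E {..<v}. shift_agrees v r (S, x)} = v * v ^ (K - card S)"
proof -
  define T where "T c = {r \<in> {..<K} \<rightarrow>\<^sub>E {..<v}. \<forall>j\<in>S. r j = (x j + c) mod v}" for c
  have "finite (T c)" for c
    by (simp add: T_def finite_PiE)
  have "T c \<inter> T d = {}" if "c < v" "d < v" "c \<noteq> d" for c d
  proof -
    obtain j where "j \<in> S"
      using \<open>S \<noteq> {}\<close> by blast
    have "(x j + c) mod v \<noteq> (x j + d) mod v"
    proof
      assume "(x j + c) mod v = (x j + d) mod v"
      then obtain a b where "c + v * a = d + v * b"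
        unfolding nat_mod_eq_iff by auto
      then have "(c + v * a) mod v = (d + v * b) mod v"
        by simp
      then show False
        using that by simp
    qed
    then show ?thesis
      using \<open>j \<in> S\<close> by (auto simp: T_def)
  qed
  moreover have "card (T c) = v ^ (K - card S)" if "c < v" for c
    using card_PiE_fixed_on[of "{..<K}" S "\<lambda>j. (x j + c) mod v" "{..<v}"] assms that
    by (simp add: T_def)
  ultimately have "card (\<Union>c<v. T c) = v * v ^ (K - card S)"
    using \<open>\<And>c. finite (T c)\<close> by (subst card_UN_disjoint) auto
  moreover have "{r \<in> {..<K} \<rightarrow>\<^sub>E {..<v}. shift_agrees v r (S, x)} = (\<Union>c<v. T c)"
    by (auto simp: T_def shift_agrees_def)
  ultimately show ?thesis
    by simp
qed

text \<open>Row \<open>v * i + d\<close> of the array is \<open>\<rho> i\<close> shifted by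
  \<open>d\<close>. If \<open>\<rho> i\<close> equals \<open>x\<close> shifted by \<open>c\<close>,
  then a further shift by \<open>v - c\<close> restores \<open>x\<close>.\<close>

lemma covering_array_of_shifts:
  assumes "v > 0" "bij_betw h {..<k} Y"
    and cover: "\<And>S x. S \<subseteq> Y \<Longrightarrow> card S = t \<Longrightarrow> x \<in> S \<rightarrow>\<^sub>E {..<v} \<Longrightarrow>
      \<exists>i<n. shift_agrees v (\<rho> i) (S, x)"
  shows "covering_array (v * n) t k {..<v} (\<lambda>i j. (\<rho> (i div v) (h j) + i mod v) mod v)"
  unfolding covering_array_def
proof (intro conjI allI impI ballI)
  show "(\<rho> (i div v) (h j) + i mod v) mod v \<in> {..<v}" for i j
    using assms(1) by simp
next
  fix S x
  assume S: "S \<subseteq> {..<k} \<and> card S = t" and x: "x \<in> S \<rightarrow>\<^sub>E {..<v}"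
  have inj: "inj_on h S"
    using assms(2) S by (meson bij_betw_def inj_on_subset)
  \<comment> \<open>The vector \<open>x\<close> carried along \<open>h\<close> to the columns in
    \<open>Y\<close>, where the covering hypothesis applies.\<close>
  define y where "y = restrict (x \<circ> the_inv_into S h) (h ` S)"
  have y: "y (h j) = x j" if "j \<in> S" for j
    using that inj by (simp add: y_def the_inv_into_f_f)
  have "h ` S \<subseteq> Y"
    using assms(2) S by (auto simp: bij_betw_def)
  moreover have "card (h ` S) = t"
    using S card_image[OF inj] by simp
  moreover have "y \<in> h ` S \<rightarrow>\<^sub>E {..<v}"
    using x y by (auto simp: PiE_iff y_def)
  ultimately obtain i c where i: "i < n" and c: "c < v"
    and agree: "\<And>j. j \<in> S \<Longrightarrow> \<rho> i (h j) = (x j + c) mod v"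
    using cover[of "h ` S" y] y by (auto simp: shift_agrees_def)
  \<comment> \<open>The reduction modulo \<open>v\<close> matters for \<open>c = 0\<close>, where
    \<open>v - c\<close> would be too large for a remainder.\<close>
  define d where "d = (v - c) mod v"
  have "d < v"
    using assms(1) by (simp add: d_def)
  have "(\<rho> i (h j) + d) mod v = x j" if "j \<in> S" for j
  proof -
    have "(\<rho> i (h j) + d) mod v = (x j + c + (v - c)) mod v"
      by (simp add: agree[OF that] d_def mod_add_eq)
    also have "\<dots> = x j"
      using x c that by (auto simp: PiE_iff)
    finally show ?thesis .
  qed
  moreover have "v * i + d < v * n"
  proof -
    have "v * i + d < v * Suc i"
      using \<open>d < v\<close> by simp
    also have "\<dots> \<le> v * n"
      using i by (intro mult_le_mono2) simp
    finally show ?thesis .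
  qed
  ultimately show "\<exists>i<v * n. \<forall>j\<in>S. (\<rho> (i div v) (h j) + i mod v) mod v = x j"
    using \<open>d < v\<close> by (intro exI[of _ "v * i + d"]) simp
qed

text \<open>The \<open>m\<close> spare columns pay for the pairs that the greedy choice leaves
  uncovered: each costs at most one column.\<close>

lemma CA_exists_if_few_uncovered:
  assumes "t \<ge> 1" "v \<ge> 1" "t \<le> K"
    and few: "(1 - real v / real v ^ t) ^ n * real ((K choose t) * v ^ t) \<le> real m"
    and K: "K = k + m"
  shows "CA_exists (v * n) t k v"
proof -
  define R where "R = {..<K} \<rightarrow>\<^sub>E {..<v}"
  define U where "U = (SIGMA S:{S. S \<subseteq> {..<K} \<and> card S = t}. S \<rightarrow>\<^sub>E {..<v})"
  have fin: "finite {S. S \<subseteq> {..<K} \<and> card S = t}"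
    by simp
  have fin_S: "finite S" if "S \<subseteq> {..<K}" for S
    using that finite_subset by blast
  have "finite R" "R \<noteq> {}"
    using \<open>v \<ge> 1\<close> by (auto simp: R_def finite_PiE PiE_eq_empty_iff lessThan_empty_iff)
  have "finite U"
    unfolding U_def by (intro finite_SigmaI fin) (auto intro!: finite_PiE fin_S)
  have card_U: "card U = (K choose t) * v ^ t"
  proof -
    have "card U = (\<Sum>S | S \<subseteq> {..<K} \<and> card S = t. card (S \<rightarrow>\<^sub>E {..<v}))"
      unfolding U_def using fin by (intro card_SigmaI) (auto intro!: finite_PiE fin_S)
    also have "\<dots> = (\<Sum>S | S \<subseteq> {..<K} \<and> card S = t. v ^ t)"
      by (intro sum.cong) (auto simp: card_PiE fin_S)
    finally show ?thesis
      by (simp add: n_subsets)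
  qed
  have "real v / real v ^ t \<le> 1"
    using assms(1,2) by (simp add: self_le_power)
  moreover have "real v / real v ^ t * card R \<le> card {r \<in> R. shift_agrees v r u}"
    if in_U: "u \<in> U" for u
  proof -
    obtain S x where u: "u = (S, x)" "S \<subseteq> {..<K}" "card S = t" "x \<in> S \<rightarrow>\<^sub>E {..<v}"
      using in_U by (auto simp: U_def)
    moreover have "S \<noteq> {}"
      using u(3) \<open>t \<ge> 1\<close> by auto
    ultimately have "card {r \<in> R. shift_agrees v r u} = v * v ^ (K - t)"
      using card_shift_agrees[of S K x v] by (simp add: R_def)
    moreover have "card R = v ^ K"
      by (simp add: R_def card_PiE)
    \<comment> \<open>This makes the fraction of good rows exactly \<open>v / v ^ t\<close>.\<close>
    moreover have "real v ^ K = real v ^ t * real v ^ (K - t)"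
      using \<open>t \<le> K\<close> by (simp flip: power_add)
    ultimately show ?thesis
      using \<open>v \<ge> 1\<close> by simp
  qed
  ultimately obtain \<rho> where \<rho>: "\<And>i. i < n \<Longrightarrow> \<rho> i \<in> R"
    and bound: "card {u \<in> U. \<forall>i<n. \<not> shift_agrees v (\<rho> i) u}
      \<le> (1 - real v / real v ^ t) ^ n * card U"
    using greedy_cover[OF \<open>finite R\<close> \<open>R \<noteq> {}\<close> \<open>finite U\<close>, of "real v / real v ^ t"
        "shift_agrees v" n]
    by blast
  \<comment> \<open>Losing one column of \<open>S\<close> disposes of all uncovered pairs
    \<open>(S, x)\<close> at once, so only the column sets are kept.\<close>
  define F where "F = fst ` {u \<in> U. \<forall>i<n. \<not> shift_agrees v (\<rho> i) u}"
  have "finite F"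
    using \<open>finite U\<close> by (simp add: F_def)
  have "{} \<notin> F"
    using \<open>t \<ge> 1\<close> by (auto simp: F_def U_def)
  have "card F \<le> card {u \<in> U. \<forall>i<n. \<not> shift_agrees v (\<rho> i) u}"
    using \<open>finite U\<close> by (simp add: F_def card_image_le)
  moreover have "real (card {u \<in> U. \<forall>i<n. \<not> shift_agrees v (\<rho> i) u}) \<le> real m"
    using bound few unfolding card_U by linarith
  ultimately have "k + card F \<le> card {..<K}"
    by (simp add: K)
  then obtain Y where Y: "Y \<subseteq> {..<K}" "card Y = k" "\<And>S. S \<in> F \<Longrightarrow> \<not> S \<subseteq> Y"
    using exists_subset_avoiding[OF _ \<open>finite F\<close> \<open>{} \<notin> F\<close>, of "{..<K}" k] by auto
  obtain h where h: "bij_betw h {..<k} Y"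
    using Y(2) fin_S[OF Y(1)] ex_bij_betw_nat_finite by (metis atLeast0LessThan)
  have "\<exists>i<n. shift_agrees v (\<rho> i) (S, x)"
    if S: "S \<subseteq> Y" "card S = t" "x \<in> S \<rightarrow>\<^sub>E {..<v}" for S x
  proof (rule ccontr)
    assume "\<not> ?thesis"
    then have "(S, x) \<in> {u \<in> U. \<forall>i<n. \<not> shift_agrees v (\<rho> i) u}"
      using S Y(1) by (auto simp: U_def)
    then have "S \<in> F"
      unfolding F_def by (rule image_eqI[rotated]) simp
    then show False
      using Y(3) S(1) by blast
  qed
  then have "covering_array (v * n) t k {..<v} (\<lambda>i j. (\<rho> (i div v) (h j) + i mod v) mod v)"
    using covering_array_of_shifts[OF _ h] \<open>v \<ge> 1\<close> by force
  then show ?thesis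
    unfolding CA_exists_def by (intro exI[of _ "{..<v}"]) auto
qed

section \<open>Choice of the number of rows, and the limit\<close>

lemma CAN_le:
  assumes "t \<ge> 2" "v \<ge> 2" "k \<ge> t"
  defines "L \<equiv> ln (real v ^ (t - 1) / (real v ^ (t - 1) - 1))"
  shows "real (CAN t k v) \<le>
    real v * ((ln ((2 * real v) ^ t) + (real t - 1) * ln (real k)) / L + 1)"
proof -
  define V where "V = real v ^ (t - 1)"
  have "V > 1"
    using assms by (simp add: V_def one_less_power)
  then have "L > 0"
    unfolding L_def V_def[symmetric] by (intro ln_gt_zero) (simp add: less_divide_eq)
  have v_pow: "real v ^ t = real v * V"
    using assms by (simp add: V_def flip: power_Suc)
  \<comment> \<open>With \<open>2 * k\<close> columns there are at most
    \<open>(2 * k) ^ t * v ^ t = k * B\<close> pairs, and \<open>k\<close> of them may stay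
    uncovered. So a decay to \<open>1 / B\<close> suffices; the allowance of \<open>k\<close> lowers
    the exponent of \<open>k\<close> from \<open>t\<close> to \<open>t - 1\<close>, the source of
    the factor \<open>t - 1\<close> in the theorem.\<close>
  define B where "B = (2 * real v) ^ t * real k ^ (t - 1)"
  have "k > 0"
    using assms by simp
  have "1 * 1 < B"
    unfolding B_def using assms by (intro mult_less_le_imp_less one_less_power one_le_power) auto
  then have "B > 1"
    by simp
  define X where "X = ln B / L"
  have X: "X = (ln ((2 * real v) ^ t) + (real t - 1) * ln (real k)) / L"
    using assms \<open>k > 0\<close> by (simp add: X_def B_def ln_mult ln_realpow of_nat_diff)
  define n where "n = nat \<lceil>X\<rceil>"
  have "X > 0"
    using \<open>B > 1\<close> \<open>L > 0\<close> by (simp add: X_def)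
  \<comment> \<open>Positivity of \<open>n\<close> is used because \<open>CAN\<close> minimises over
    positive \<open>N\<close>; the rounding up costs the summand 1.\<close>
  then have n: "n > 0" "X \<le> n" "n \<le> X + 1"
    unfolding n_def by linarith+
  \<comment> \<open>A random row fails for a given pair with probability
    \<open>1 - 1 / V = (V - 1) / V\<close>, and \<open>L\<close> is minus the logarithm of
    this.\<close>
  have q: "1 - real v / real v ^ t = exp (- L)"
    using \<open>V > 1\<close> assms(2) unfolding L_def V_def[symmetric] v_pow
    by (simp add: exp_minus diff_divide_distrib)
  have "exp (- L) ^ n = exp (- (n * L))"
    by (simp flip: exp_of_nat_mult)
  also have "\<dots> \<le> exp (- ln B)"
    using n(2) \<open>L > 0\<close> by (simp add: X_def field_simps)
  also have "\<dots> = 1 / B"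
    using \<open>B > 1\<close> by (simp add: exp_minus field_simps)
  finally have decay: "exp (- L) ^ n \<le> 1 / B" .
  have "real ((2 * k) choose t) \<le> real ((2 * k) ^ t)"
    unfolding of_nat_le_iff using assms(3) by (intro binomial_le_pow) simp
  then have "real ((2 * k) choose t) \<le> (2 * real k) ^ t"
    by simp
  then have "real (((2 * k) choose t) * v ^ t) \<le> (2 * real k) ^ t * real v ^ t"
    by (simp add: mult_right_mono)
  also have "\<dots> = real k * B"
    using power_minus_mult[of t "real k"] assms(1)
    by (simp add: B_def power_mult_distrib mult_ac)
  finally have "exp (- L) ^ n * real (((2 * k) choose t) * v ^ t) \<le> 1 / B * (real k * B)"
    using decay \<open>B > 1\<close> by (intro mult_mono) auto
  also have "\<dots> = real k"
    using \<open>B > 1\<close> by simp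
  finally have "CA_exists (v * n) t k v"
    using assms q by (intro CA_exists_if_few_uncovered[of t v "2 * k" n k]) auto
  then have "CAN t k v \<le> v * n"
    unfolding CAN_def using n(1) assms by (intro Least_le) auto
  then have "real (CAN t k v) \<le> real v * real n"
    by (metis of_nat_le_iff of_nat_mult)
  also have "\<dots> \<le> real v * (X + 1)"
    using n(3) by (intro mult_left_mono) auto
  finally show ?thesis
    unfolding X .
qed

theorem theorem6:
  fixes t v :: nat
  assumes "t \<ge> 2" and "v \<ge> 2"
  shows "CAN_limsup t v \<le>
    ereal (real v * (real t - 1) / ln (real v ^ (t - 1) / (real v ^ (t - 1) - 1)))"
proof -
  define L where "L = ln (real v ^ (t - 1) / (real v ^ (t - 1) - 1))"
  \<comment> \<open>The part of the bound in \<open>CAN_le\<close> that is independent of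
    \<open>k\<close>; it vanishes after division by \<open>ln k\<close>.\<close>
  define D where "D = real v * (ln ((2 * real v) ^ t) / L + 1)"
  define g where "g k = real v * (real t - 1) / L + D / ln (real k)" for k :: nat
  have "filterlim (\<lambda>k. ln (real k)) at_top sequentially"
    by (rule filterlim_compose[OF ln_at_top filterlim_real_sequentially])
  then have "(\<lambda>k. D / ln (real k)) \<longlonglongrightarrow> 0"
    by (intro real_tendsto_divide_at_top[OF tendsto_const])
  then have lim: "g \<longlonglongrightarrow> real v * (real t - 1) / L"
    unfolding g_def using tendsto_add[OF tendsto_const] by force
  have "real (CAN t k v) / ln (real k) \<le> g k" if "k \<ge> t" for k
  proof -
    have "ln (real k) > 0"
      using that assms by simp
    moreover have "real (CAN t k v) \<le> D + real v * (real t - 1) / L * ln (real k)"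
      using CAN_le[OF assms that] unfolding D_def L_def[symmetric]
      by (simp add: add_divide_distrib ring_distribs mult.assoc)
    ultimately show ?thesis
      by (simp add: g_def pos_divide_le_eq distrib_right)
  qed
  then have "limsup (\<lambda>k. ereal (real (CAN t k v) / ln (real k))) \<le> limsup (\<lambda>k. ereal (g k))"
    by (intro Limsup_mono eventually_sequentiallyI[of t]) simp
  also have "\<dots> = ereal (real v * (real t - 1) / L)"
    using lim by (intro lim_imp_Limsup) auto
  finally show ?thesis
    by (simp add: CAN_limsup_def L_def)
qed

end
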